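(* Let $X,Y$ be separable Hilbert spaces, let $(X_N)_{N\in\mathbb{N}_0}$ be a nested family of subspaces of $X$ with orthogonal projectors $P_N:X\to X_N$, and let $T_N:X_N\to Y$ be linear operators with (i) $\|T_N\|\le 1$, (ii) $T_Nx_M=T_Mx_M$ for all $N\ge M$ and $x_M\in X_M$, (iii) $\mathcal{R}(T_N^* )\subseteq X_N$. Let $y\in Y$ and assume that there exist $N_*\in\mathbb{N}_0$ and $x_*\in X_{N_*}$ with $T_{N_*}x_*=y$, and that $T_{N_*}^*$ is continuously invertible. Let $\eta>0$ and $\tau>1$. Suppose that $y^\delta\in Y$ fulfills $\|y^\delta-y\|\le\delta$, that in the multi-level Landweber–Richardson algorithm the iteration at level $N$ is stopped according to the discrepancy principle $$\|T_Nx_{k,N}^\delta-y^\delta\|>2(1+\eta)\left(\delta+\|P_Nx_*-x_*\|\right)\quad\text{for }0\le k\le l_*(N,\delta),$$ and that the multi-level iteration is terminated when for the first time $$\|T_Nx_{k,N}^\delta-y^\delta\|\le 2(1+\eta)\tau\delta.$$ Denote by $N(\delta)$ the level and by $L_*(N(\delta),\delta)$ the iteration index at which this termination occurs. Then $$x_{L_*(N(\delta),\delta),N(\delta)}^\delta\to x_*\qquad\text{as }\delta\to 0.$$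
   Context: Nested means $X_N\subseteq X_{N+1}$ for all $N$. Landweber–Richardson iteration at level $N$: $x_{k+1,N}^\delta=x_{k,N}^\delta-T_N^*(T_Nx_{k,N}^\delta-y^\delta)$, $k=0,1,2,\dots$ ($k$ iteration index, $N$ level). Multi-level Landweber–Richardson algorithm (parameters $\eta>0$, $\tau>1$, noise level $\delta$, data $y^\delta$). Level $0$: given $x_{0,0}^\delta\in X_0$, consider the conditions (a) $\|T_0x_{0,0}^\delta-y^\delta\|>2(1+\eta)(\delta+\|P_0x_*-x_*\|)$ and (b) $\|T_0x_{0,0}^\delta-y^\delta\|>2(1+\eta)\tau\delta$. If (b) fails, $x_{0,0}^\delta$ is accepted as approximate solution and the algorithm terminates. If (b) holds and (a) fails, one chooses a level $J$ with $\|T_Jx_{0,0}^\delta-y^\delta\|>2(1+\eta)(\delta+\|P_Jx_*-x_*\|)$ and renumbers the levels so that $J$ becomes level $0$. Then the Landweber–Richardson iteration is run at level $0$ from $x_{0,0}^\delta$ until, for the first time, $\|T_0x_{k+1,0}^\delta-y^\delta\|\le 2(1+\eta)(\delta+\|P_0x_*-x_*\|)$; this $k$ is denoted $l_*(0,\delta)$. From level $N$ to level $N+1$: unless the multi-level iteration has been terminated by $\|T_Nx_{k,N}^\delta-y^\delta\|\le 2(1+\eta)\tau\delta$ (this includes the test of $x_{l_*(N,\delta)+1,N}^\delta$), set $x_{0,N+1}^\delta:=x_{l_*(N,\delta),N}^\delta$ and run the Landweber–Richardson iteration at level $N+1$ from $x_{0,N+1}^\delta$ until, for the first time, $\|T_{N+1}x_{k+1,N+1}^\delta-y^\delta\|\le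 2(1+\eta)(\delta+\|P_{N+1}x_*-x_*\|)$; this $k$ is denoted $l_*(N+1,\delta)$.
   Formalization: The level J chosen to become level 0 is required to satisfy J ≤ N_*, so that level N_* survives the renumbering; with J > N_* allowed the claim fails, since T_J may have a nontrivial kernel and the iterates may converge to another solution. *)

theory Defs
  imports "HOL-Analysis.Analysis"
begin

text \<open>
  Operators given only on a subspace are represented by total functions whose values
  outside the subspace are irrelevant.
\<close>

definition bounded_linear_on ::
  "'a::real_normed_vector set \<Rightarrow> ('a \<Rightarrow> 'b::real_normed_vector) \<Rightarrow> bool" where
  "bounded_linear_on S f \<longleftrightarrow>
     (\<forall>u\<in>S. \<forall>v\<in>S. f (u + v) = f u + f v) \<and>
     (\<forall>c. \<forall>u\<in>S. f (c *\<^sub>R u) = c *\<^sub>R f u) \<and>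
     (\<exists>K. \<forall>u\<in>S. norm (f u) \<le> norm u * K)"

text \<open>The relative version of \<^const>\<open>onorm\<close>; meaningful for bounded operators only.\<close>

definition onorm_on ::
  "'a::real_normed_vector set \<Rightarrow> ('a \<Rightarrow> 'b::real_normed_vector) \<Rightarrow> real" where
  "onorm_on S f = (SUP u\<in>S. norm (f u) / norm u)"

text \<open>
  Only together with \<open>range f' \<subseteq> S\<close> is \<open>f'\<close> determined by this property; it is then the
  Hilbert space adjoint of \<open>f\<close> as an operator on \<open>S\<close>.
\<close>

definition adjoint_on ::
  "'a::real_inner set \<Rightarrow> ('a \<Rightarrow> 'b::real_inner) \<Rightarrow> ('b \<Rightarrow> 'a) \<Rightarrow> bool" where
  "adjoint_on S f f' \<longleftrightarrow> (\<forall>u\<in>S. \<forall>v. f u \<bullet> v = u \<bullet> f' v)"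

definition orthogonal_projector :: "'a::real_inner set \<Rightarrow> ('a \<Rightarrow> 'a) \<Rightarrow> bool" where
  "orthogonal_projector S P \<longleftrightarrow> (\<forall>u. P u \<in> S \<and> (\<forall>v\<in>S. orthogonal (u - P u) v))"

primrec landweber ::
  "('a::real_inner \<Rightarrow> 'b::real_inner) \<Rightarrow> ('b \<Rightarrow> 'a) \<Rightarrow> 'b \<Rightarrow> 'a \<Rightarrow> nat \<Rightarrow> 'a" where
  "landweber A A' d u 0 = u"
| "landweber A A' d u (Suc k) =
     landweber A A' d u k - A' (A (landweber A A' d u k) - d)"

definition stop_index ::
  "('a::real_inner \<Rightarrow> 'b::real_inner) \<Rightarrow> ('b \<Rightarrow> 'a) \<Rightarrow> 'b \<Rightarrow> real \<Rightarrow> 'a \<Rightarrow> nat" where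
  "stop_index A A' d c u = (LEAST k. norm (A (landweber A A' d u (Suc k)) - d) \<le> c)"

text \<open>
  The multi-level algorithm for operators \<open>T N\<close> with adjoints \<open>T' N\<close>, data \<open>d\<close>, level
  tolerances \<open>c N\<close> of the discrepancy principle, termination tolerance \<open>e\<close> and initial
  element \<open>u\<close>.  The iterates are continued past termination; this is harmless, because
  \<open>ml_level\<close> and \<open>ml_index\<close> pick the first iterate passing the termination test in the
  order in which the algorithm visits them, the test of the iterate with index
  \<open>ml_stop N + 1\<close> on level \<open>N\<close> included.  As \<open>LEAST\<close> is unspecified if there is no
  witness, nothing can be proved about the result unless the algorithm terminates.
\<close>

context
  fixes T :: "nat \<Rightarrow> 'a::real_inner \<Rightarrow> 'b::real_inner"
    and T' :: "nat \<Rightarrow> 'b \<Rightarrow> 'a"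
    and d :: 'b
    and c :: "nat \<Rightarrow> real"
    and e :: real
    and u :: 'a
begin

primrec ml_init :: "nat \<Rightarrow> 'a" where
  "ml_init 0 = u"
| "ml_init (Suc N) =
     landweber (T N) (T' N) d (ml_init N) (stop_index (T N) (T' N) d (c N) (ml_init N))"

definition ml_iter :: "nat \<Rightarrow> nat \<Rightarrow> 'a" where
  "ml_iter N k = landweber (T N) (T' N) d (ml_init N) k"

definition ml_stop :: "nat \<Rightarrow> nat" where
  "ml_stop N = stop_index (T N) (T' N) d (c N) (ml_init N)"

definition ml_level :: nat where
  "ml_level = (LEAST N. \<exists>k\<le>ml_stop N + 1. norm (T N (ml_iter N k) - d) \<le> e)"

definition ml_index :: nat where
  "ml_index = (LEAST k. norm (T ml_level (ml_iter ml_level k) - d) \<le> e)"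

definition ml_result :: 'a where
  "ml_result = ml_iter ml_level ml_index"

end

definition level_tol ::
  "real \<Rightarrow> real \<Rightarrow> (nat \<Rightarrow> 'a \<Rightarrow> 'a) \<Rightarrow> 'a::real_normed_vector \<Rightarrow> nat \<Rightarrow> real" where
  "level_tol \<eta> \<delta> P xs N = 2 * (1 + \<eta>) * (\<delta> + norm (P N xs - xs))"

definition term_tol :: "real \<Rightarrow> real \<Rightarrow> real \<Rightarrow> real" where
  "term_tol \<eta> \<tau> \<delta> = 2 * (1 + \<eta>) * \<tau> * \<delta>"

text \<open>
  \<open>J\<close> is an admissible choice of the level that becomes level 0 by renumbering: a level
  other than 0 is used only if the initial element is not accepted outright and its
  residual does not exceed the tolerance of level 0.  (An assumption that some \<open>X Ns\<close>
  contains the solution is about the renumbered family, so it entails \<open>J \<le> Ns\<close>.)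
\<close>

definition start_level ::
  "(nat \<Rightarrow> 'a::real_inner \<Rightarrow> 'b::real_inner) \<Rightarrow> 'b \<Rightarrow> (nat \<Rightarrow> real) \<Rightarrow> real \<Rightarrow> 'a \<Rightarrow> nat \<Rightarrow> bool"
  where
  "start_level T d c e u J \<longleftrightarrow>
     (if norm (T 0 u - d) > e \<and> \<not> norm (T 0 u - d) > c 0
      then norm (T J u - d) > c J
      else J = 0)"

end

theory Submission
  imports Defs
begin

text \<open>
  Since the adjoint of \<open>T Ns\<close> is boundedly invertible, so is \<open>T Ns\<close>, and by the compatibility
  of the levels every \<open>T N\<close> with \<open>N \<le> Ns\<close> is bounded below on \<open>X N\<close> by the same constant
  \<open>s\<close>.  At level \<open>Ns\<close> each Landweber step lowers the squared residual by at least
  \<open>s\<^sup>2\<close> times its value, and \<open>P Ns xs = xs\<close> makes the tolerance of the discrepancy principle smaller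
  than the termination tolerance; so the algorithm terminates at a level \<open>N \<le> Ns\<close>.  There the
  residual is \<open>O(\<delta>)\<close>, and the lower bound turns this into an \<open>O(\<delta>)\<close> bound on the error.
\<close>

text \<open>A real \<open>SUP\<close> dominates its members only if they are bounded above, which is
  what the constant from \<open>bounded_linear_on\<close> supplies. The quotient is 0 at
  \<open>u = 0\<close> by convention and says nothing about \<open>f 0\<close>, hence the separate
  case.\<close>

lemma onorm_on_le_1_bound:
  assumes "bounded_linear_on S f" "onorm_on S f \<le> 1" "u \<in> S"
  shows "norm (f u) \<le> norm u"
proof (cases "u = 0")
  case True
  from assms(1) obtain K where "norm (f u) \<le> norm u * K"
    using assms(3) unfolding bounded_linear_on_def by blast
  with True show ?thesis by simp
next
  case False
  from assms(1) obtain K where K: "\<And>v. v \<in> S \<Longrightarrow> norm (f v) \<le> norm v * K"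
    unfolding bounded_linear_on_def by blast
  have "norm (f v) / norm v \<le> \<bar>K\<bar>" if "v \<in> S" for v
  proof (cases "v = 0")
    case False
    have "norm (f v) \<le> norm v * \<bar>K\<bar>"
      using K[OF that] by (rule order_trans) (simp add: mult_left_mono)
    with False show ?thesis by (simp add: divide_le_eq mult.commute)
  qed simp
  then have "bdd_above ((\<lambda>v. norm (f v) / norm v) ` S)"
    by (rule bdd_aboveI2)
  from cSUP_upper[OF assms(3) this] assms(2) have "norm (f u) / norm u \<le> 1"
    unfolding onorm_on_def by linarith
  with False show ?thesis by (simp add: divide_le_eq)
qed

lemma bounded_linear_on_diff:
  assumes "bounded_linear_on S f" "subspace S" "u \<in> S" "v \<in> S"
  shows "f (u - v) = f u - f v"
proof -
  have "f (u + (-1) *\<^sub>R v) = f u + f ((-1) *\<^sub>R v)" "f ((-1) *\<^sub>R v) = (-1) *\<^sub>R f v"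
    using assms subspace_scale[OF assms(2,4)] unfolding bounded_linear_on_def by blast+
  then show ?thesis by simp
qed

lemma orthogonal_projector_fixes:
  assumes "orthogonal_projector S P" "subspace S" "x \<in> S"
  shows "P x = x"
proof -
  have "P x \<in> S" and *: "\<And>v. v \<in> S \<Longrightarrow> orthogonal (x - P x) v"
    using assms(1) unfolding orthogonal_projector_def by auto
  then have "x - P x \<in> S" using assms by (simp add: subspace_diff)
  from *[OF this] show ?thesis by (simp add: orthogonal_def)
qed

text \<open>Linearity of \<open>f'\<close> has to be derived from \<open>adjoint_on\<close>. The
  difference \<open>?z\<close> of the two sides lies in \<open>S\<close>, so pairing it with values
  of \<open>f'\<close> moves \<open>f\<close> onto \<open>?z\<close>; homogeneity of the inner
  product then gives \<open>?z \<bullet> ?z = 0\<close>.\<close>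

lemma adjoint_on_scaleR:
  assumes "adjoint_on S f f'" "subspace S" "range f' \<subseteq> S"
  shows "f' (a *\<^sub>R v) = a *\<^sub>R f' v"
proof -
  have "f' (a *\<^sub>R v) - a *\<^sub>R f' v \<in> S" (is "?z \<in> S")
    using assms by (auto intro!: subspace_diff subspace_scale)
  then have eq: "?z \<bullet> f' w = f ?z \<bullet> w" for w
    using assms(1) unfolding adjoint_on_def by auto
  have "?z \<bullet> ?z = ?z \<bullet> f' (a *\<^sub>R v) - a * (?z \<bullet> f' v)"
    by (simp only: inner_diff_right inner_scaleR_right)
  also have "\<dots> = 0" unfolding eq by simp
  finally show ?thesis by simp
qed

text \<open>Continuity of the inverse at 0, scaled by homogeneity, bounds \<open>f'\<close> below.
  Surjectivity onto \<open>S\<close> carries the bound to \<open>f\<close> by duality: for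
  \<open>u = f' v\<close>, the square of \<open>norm u\<close> is \<open>f u \<bullet> v\<close>,
  and \<open>norm v\<close> is at most \<open>norm u / s\<close>.\<close>

lemma homeomorphism_adjoint_bounded_below:
  assumes adj: "adjoint_on S f f'" and sub: "subspace S" and ran: "range f' \<subseteq> S"
    and hom: "homeomorphism UNIV S f' g"
  obtains s where "s > 0" "\<And>v. s * norm v \<le> norm (f' v)" "\<And>u. u \<in> S \<Longrightarrow> s * norm u \<le> norm (f u)"
proof -
  have zero: "f' 0 = 0"
    using adjoint_on_scaleR[OF adj sub ran, of 0 0] by simp
  have inv: "g (f' v) = v" for v using hom by (simp add: homeomorphism_def)
  then have g0: "g 0 = 0" using zero by metis
  have "continuous_on S g" "0 \<in> S" using hom sub by (auto simp: homeomorphism_def subspace_0)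
  then obtain s where s: "s > 0" "\<And>u. u \<in> S \<Longrightarrow> dist u 0 < s \<Longrightarrow> dist (g u) (g 0) < 1"
    unfolding continuous_on_iff by (metis zero_less_one)
  have low: "s * norm v \<le> norm (f' v)" for v
  proof (cases "v = 0")
    case False
    let ?w = "(1 / norm v) *\<^sub>R v"
    have "f' ?w \<in> S" using ran by auto
    \<comment> \<open>\<open>g\<close> sends \<open>f' ?w\<close> back to the unit vector
      \<open>?w\<close>, so \<open>f' ?w\<close> cannot lie in the open ball of radius
      \<open>s\<close>, which \<open>g\<close> maps into the open unit ball.\<close>
    from s(2)[OF this] False have "s \<le> norm (f' ?w)"
      unfolding g0 inv by force
    also have "norm (f' ?w) = norm (f' v) / norm v"
      unfolding adjoint_on_scaleR[OF adj sub ran] by simp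
    finally show ?thesis using False by (simp add: pos_le_divide_eq)
  qed (simp add: zero)
  have "s * norm u \<le> norm (f u)" if "u \<in> S" for u
  proof (cases "u = 0")
    case False
    have "u \<in> range f'" using hom that by (simp add: homeomorphism_def)
    then obtain v where v: "u = f' v" by blast
    have "norm u * norm u = f u \<bullet> v"
      using adj that v unfolding adjoint_on_def by (simp add: power2_norm_eq_inner flip: power2_eq_square)
    also have "\<dots> \<le> norm (f u) * norm v" by (rule norm_cauchy_schwarz)
    finally have "s * (norm u * norm u) \<le> norm (f u) * (s * norm v)"
      using s(1) by (simp add: mult.left_commute)
    also have "\<dots> \<le> norm (f u) * norm u"
      using low[of v] v by (simp add: mult_left_mono)
    finally show ?thesis using False by (simp add: mult.assoc[symmetric])
  qed simp
  with s(1) low show thesis by (rule that)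
qed

lemma landweber_in_subspace:
  assumes "subspace S" "range A' \<subseteq> S" "u \<in> S"
  shows "landweber A A' d u k \<in> S"
  using assms by (induction k) (auto intro!: subspace_diff)

text \<open>One step turns the residual \<open>r\<close> into \<open>r - A (A' r)\<close>. Expanding
  the square, adjointness makes the mixed term minus twice the square of \<open>norm (A' r)\<close>,
  and the contraction \<open>A\<close> lets the quadratic term use up only one of these two
  copies.\<close>

lemma landweber_residual_decrease:
  assumes lin: "bounded_linear_on S A" and norm: "onorm_on S A \<le> 1"
    and adj: "adjoint_on S A A'" and sub: "subspace S" and ran: "range A' \<subseteq> S"
    and u: "u \<in> S"
  shows "(norm (A (landweber A A' d u (Suc k)) - d))\<^sup>2
    \<le> (norm (A (landweber A A' d u k) - d))\<^sup>2 - (norm (A' (A (landweber A A' d u k) - d)))\<^sup>2"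
proof -
  define x where "x = landweber A A' d u k"
  define r where "r = A x - d"
  have "x \<in> S" unfolding x_def by (rule landweber_in_subspace[OF sub ran u])
  moreover have r': "A' r \<in> S" using ran by auto
  ultimately have eq: "A (landweber A A' d u (Suc k)) - d = r - A (A' r)"
    using bounded_linear_on_diff[OF lin sub] by (simp add: x_def r_def)
  have "A (A' r) \<bullet> r = A' r \<bullet> A' r"
    using adj r' unfolding adjoint_on_def by blast
  then have "(norm (r - A (A' r)))\<^sup>2 = (norm r)\<^sup>2 - 2 * (norm (A' r))\<^sup>2 + (norm (A (A' r)))\<^sup>2"
    by (simp add: power2_norm_eq_inner inner_diff inner_commute)
  moreover have "(norm (A (A' r)))\<^sup>2 \<le> (norm (A' r))\<^sup>2"
    using onorm_on_le_1_bound[OF lin norm r'] by (simp add: power_mono)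
  ultimately show ?thesis unfolding eq x_def[symmetric] r_def[symmetric] by linarith
qed

lemma landweber_discrepancy_reached:
  assumes "bounded_linear_on S A" "onorm_on S A \<le> 1"
    and "adjoint_on S A A'" "subspace S" "range A' \<subseteq> S" "u \<in> S"
    and s: "s > 0" "\<And>v. s * norm v \<le> norm (A' v)" and c: "c > 0"
  shows "\<exists>k. norm (A (landweber A A' d u (Suc k)) - d) \<le> c"
proof (rule ccontr)
  \<comment> \<open>The sequence starts with iterate 1, since the discrepancy test in
    \<open>stop_index\<close> looks at \<open>Suc k\<close>.\<close>
  define r where "r k = A (landweber A A' d u (Suc k)) - d" for k
  assume "\<not> ?thesis"
  then have big: "c < norm (r k)" for k by (simp add: not_le r_def del: landweber.simps)
  \<comment> \<open>As long as the residual exceeds \<open>c\<close>, each step costs its square a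
    fixed positive amount, which a nonnegative quantity cannot afford forever.\<close>
  have step: "(norm (r (Suc k)))\<^sup>2 \<le> (norm (r k))\<^sup>2 - (s * c)\<^sup>2" for k
  proof -
    have "s * c \<le> norm (A' (r k))"
      using s(2)[of "r k"] mult_left_mono[of c "norm (r k)" s] big[of k] s(1) by linarith
    then have "(s * c)\<^sup>2 \<le> (norm (A' (r k)))\<^sup>2"
      using s(1) c by (simp add: power_mono)
    with landweber_residual_decrease[OF assms(1-6), of d "Suc k"] show ?thesis
      unfolding r_def by linarith
  qed
  have "(norm (r k))\<^sup>2 \<le> (norm (r 0))\<^sup>2 - real k * (s * c)\<^sup>2" for k
  proof (induction k)
    case (Suc k)
    with step[of k] show ?case by (simp add: algebra_simps)
  qed simp
  then have "real k * (s * c)\<^sup>2 \<le> (norm (r 0))\<^sup>2" for k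
    by (meson diff_ge_0_iff_ge order_trans zero_le_power2)
  moreover obtain k where "(norm (r 0))\<^sup>2 < real k * (s * c)\<^sup>2"
    using reals_Archimedean3[of "(s * c)\<^sup>2"] s(1) c by auto
  ultimately show False by (meson not_le)
qed

lemma ml_init_in_subspace:
  assumes "\<And>N. subspace (X N)" "\<And>N. X N \<subseteq> X (Suc N)" "\<And>N. range (T' N) \<subseteq> X N" "u \<in> X 0"
  shows "ml_init T T' d c u N \<in> X N"
proof (induction N)
  case (Suc N)
  have "ml_init T T' d c u (Suc N) \<in> X N"
    using landweber_in_subspace[OF assms(1,3) Suc] by simp
  with assms(2) show ?case by blast
qed (use assms in simp)

lemma ml_iter_in_subspace:
  assumes "\<And>N. subspace (X N)" "\<And>N. X N \<subseteq> X (Suc N)" "\<And>N. range (T' N) \<subseteq> X N" "u \<in> X 0"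
  shows "ml_iter T T' d c u N k \<in> X N"
  unfolding ml_iter_def
  by (intro landweber_in_subspace ml_init_in_subspace assms)

text \<open>One iterate passing the test within the range of some level gives
  \<open>ml_level\<close> a witness; the witness on the level so found then serves for
  \<open>ml_index\<close>.\<close>

lemma ml_result_residual:
  assumes "norm (T M (ml_iter T T' d c u M k) - d) \<le> e" "k \<le> ml_stop T T' d c u M + 1"
  shows "ml_level T T' d c e u \<le> M"
    and "norm (T (ml_level T T' d c e u) (ml_result T T' d c e u) - d) \<le> e"
proof -
  let ?Q = "\<lambda>N. \<exists>k\<le>ml_stop T T' d c u N + 1. norm (T N (ml_iter T T' d c u N k) - d) \<le> e"
  have Q: "?Q M" using assms by blast
  then show "ml_level T T' d c e u \<le> M" unfolding ml_level_def by (rule Least_le)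
  have "?Q (ml_level T T' d c e u)" unfolding ml_level_def using Q by (rule LeastI)
  then obtain l where "norm (T (ml_level T T' d c e u)
      (ml_iter T T' d c u (ml_level T T' d c e u) l) - d) \<le> e" by blast
  then show "norm (T (ml_level T T' d c e u) (ml_result T T' d c e u) - d) \<le> e"
    unfolding ml_result_def ml_index_def by (rule LeastI)
qed

theorem theorem3p6:
  fixes X :: "nat \<Rightarrow> 'a::{real_inner, complete_space, second_countable_topology} set"
    and P :: "nat \<Rightarrow> 'a \<Rightarrow> 'a"
    and T :: "nat \<Rightarrow> 'a \<Rightarrow> 'b::{real_inner, complete_space, second_countable_topology}"
    and T' :: "nat \<Rightarrow> 'b \<Rightarrow> 'a"
    and y :: 'b and xs :: 'a and Ns :: nat
    and \<eta> \<tau> :: real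
    and yd :: "real \<Rightarrow> 'b"
    and x0 :: "real \<Rightarrow> 'a"
    and J :: "real \<Rightarrow> nat"
  assumes "\<And>N. subspace (X N)"
    and "\<And>N. X N \<subseteq> X (Suc N)"
    and "\<And>N. orthogonal_projector (X N) (P N)"
    and "\<And>N. bounded_linear_on (X N) (T N)"
    and "\<And>N. onorm_on (X N) (T N) \<le> 1"
    and "\<And>M N x. M \<le> N \<Longrightarrow> x \<in> X M \<Longrightarrow> T N x = T M x"
    and "\<And>N. adjoint_on (X N) (T N) (T' N)"
    and "\<And>N. range (T' N) \<subseteq> X N"
    and "xs \<in> X Ns" and "T Ns xs = y"
    and "\<exists>g. homeomorphism UNIV (X Ns) (T' Ns) g"
    and "\<eta> > 0" and "\<tau> > 1"
    and "\<And>\<delta>. \<delta> > 0 \<Longrightarrow> norm (yd \<delta> - y) \<le> \<delta>"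
    and "\<And>\<delta>. \<delta> > 0 \<Longrightarrow> x0 \<delta> \<in> X 0"
    and "\<And>\<delta>. \<delta> > 0 \<Longrightarrow>
           start_level T (yd \<delta>) (level_tol \<eta> \<delta> P xs) (term_tol \<eta> \<tau> \<delta>) (x0 \<delta>) (J \<delta>)"
    and "\<And>\<delta>. \<delta> > 0 \<Longrightarrow> J \<delta> \<le> Ns"
  shows "((\<lambda>\<delta>. ml_result (\<lambda>N. T (J \<delta> + N)) (\<lambda>N. T' (J \<delta> + N)) (yd \<delta>)
                 (\<lambda>N. level_tol \<eta> \<delta> P xs (J \<delta> + N)) (term_tol \<eta> \<tau> \<delta>) (x0 \<delta>))
          \<longlongrightarrow> xs) (at_right 0)"
proof -
  note sub = assms(1) and nest = assms(2) and bl = assms(4) and on = assms(5)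
    and compat = assms(6) and adj = assms(7) and ran = assms(8)
  obtain g where g: "homeomorphism UNIV (X Ns) (T' Ns) g" using assms(11) by blast
  obtain s where s: "s > 0" "\<And>v. s * norm v \<le> norm (T' Ns v)"
    "\<And>u. u \<in> X Ns \<Longrightarrow> s * norm u \<le> norm (T Ns u)"
    using homeomorphism_adjoint_bounded_below[OF adj sub ran g] by blast
  have mono: "X M \<subseteq> X N" if "M \<le> N" for M N
    using lift_Suc_mono_le[of X, OF nest that] .
  define res where "res \<delta> = ml_result (\<lambda>N. T (J \<delta> + N)) (\<lambda>N. T' (J \<delta> + N)) (yd \<delta>)
    (\<lambda>N. level_tol \<eta> \<delta> P xs (J \<delta> + N)) (term_tol \<eta> \<tau> \<delta>) (x0 \<delta>)" for \<delta>
  \<comment> \<open>The numerator collects the termination tolerance and the data noise, each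
    divided by \<open>\<delta>\<close>; \<open>1 / s\<close> bounds the inverse of
    \<open>T Ns\<close>.\<close>
  define K where "K = (2 * (1 + \<eta>) * \<tau> + 1) / s"
  have bound: "norm (res \<delta> - xs) \<le> K * \<delta>" if \<delta>: "\<delta> > 0" for \<delta>
  proof -
    define j where "j = J \<delta>"
    let ?T = "\<lambda>N. T (j + N)" and ?T' = "\<lambda>N. T' (j + N)"
    let ?c = "\<lambda>N. level_tol \<eta> \<delta> P xs (j + N)" and ?e = "term_tol \<eta> \<tau> \<delta>"
    \<comment> \<open>\<open>?M\<close> is the number that level \<open>Ns\<close> carries after
      renumbering.\<close>
    let ?M = "Ns - j" and ?N = "ml_level ?T ?T' (yd \<delta>) ?c ?e (x0 \<delta>)"
    have jM: "j + ?M = Ns" using assms(17)[OF \<delta>] by (simp add: j_def)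
    have x0: "x0 \<delta> \<in> X (j + 0)" using assms(15)[OF \<delta>] mono[of 0 j] by auto
    have nest': "X (j + N) \<subseteq> X (j + Suc N)" for N using nest by simp
    \<comment> \<open>The projection error of \<open>xs\<close> vanishes at level \<open>Ns\<close>,
      so only the noise part of the tolerance remains; as \<open>\<tau> > 1\<close>, it is below the
      termination tolerance.\<close>
    have cM: "?c ?M = 2 * (1 + \<eta>) * \<delta>"
      using orthogonal_projector_fixes[OF assms(3) sub assms(9)]
      by (simp add: jM level_tol_def)
    have "0 < ?c ?M" unfolding cM using assms(12) \<delta> by simp
    define v where "v = ml_init ?T ?T' (yd \<delta>) ?c (x0 \<delta>) ?M"
    have "v \<in> X (j + ?M)" unfolding v_def
      by (rule ml_init_in_subspace[where X = "\<lambda>N. X (j + N)", OF sub nest' ran x0])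
    then have "v \<in> X Ns" by (simp only: jM)
    then have "\<exists>k. norm (T Ns (landweber (T Ns) (T' Ns) (yd \<delta>) v (Suc k)) - yd \<delta>) \<le> ?c ?M"
      by (rule landweber_discrepancy_reached[OF bl on adj sub ran _ s(1,2) \<open>0 < ?c ?M\<close>])
    \<comment> \<open>The iterate reaching the discrepancy has index \<open>ml_stop + 1\<close>, the
      last one that the termination test on this level includes.\<close>
    from LeastI_ex[OF this]
    have "norm (?T ?M (ml_iter ?T ?T' (yd \<delta>) ?c (x0 \<delta>) ?M
        (ml_stop ?T ?T' (yd \<delta>) ?c (x0 \<delta>) ?M + 1)) - yd \<delta>) \<le> ?c ?M"
      unfolding ml_iter_def ml_stop_def stop_index_def v_def[symmetric] jM Suc_eq_plus1 .
    also have "?c ?M \<le> ?e"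
      unfolding cM term_tol_def using assms(12,13) \<delta> by simp
    finally have stop: "norm (?T ?M (ml_iter ?T ?T' (yd \<delta>) ?c (x0 \<delta>) ?M
        (ml_stop ?T ?T' (yd \<delta>) ?c (x0 \<delta>) ?M + 1)) - yd \<delta>) \<le> ?e" .
    have level: "j + ?N \<le> Ns"
      using ml_result_residual(1)[where T = ?T, OF stop order_refl] jM by linarith
    have resid: "norm (T (j + ?N) (res \<delta>) - yd \<delta>) \<le> ?e"
      using ml_result_residual(2)[where T = ?T, OF stop order_refl] by (simp add: res_def j_def)
    have inN: "res \<delta> \<in> X (j + ?N)"
      unfolding res_def ml_result_def j_def[symmetric]
      by (rule ml_iter_in_subspace[where X = "\<lambda>N. X (j + N)", OF sub nest' ran x0])
    then have inNs: "res \<delta> \<in> X Ns" using mono[OF level] by blast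
    have "s * norm (res \<delta> - xs) \<le> norm (T Ns (res \<delta> - xs))"
      using s(3) subspace_diff[OF sub inNs assms(9)] by blast
    \<comment> \<open>Since the final level is at most \<open>Ns\<close>, compatibility replaces
      \<open>T Ns\<close> on \<open>res \<delta>\<close> by the operator of that level, whose
      residual is controlled.\<close>
    also have "T Ns (res \<delta> - xs) = (T (j + ?N) (res \<delta>) - yd \<delta>) + (yd \<delta> - y)"
      using bounded_linear_on_diff[OF bl sub inNs assms(9)] compat[OF level inN] assms(10) by simp
    also have "norm \<dots> \<le> ?e + \<delta>"
      using norm_triangle_mono[OF resid assms(14)[OF \<delta>]] .
    finally show ?thesis
      using s(1) by (simp add: K_def term_tol_def field_simps)
  qed
  have "((\<lambda>\<delta>. K * \<delta>) \<longlongrightarrow> K * 0) (at_right 0)" by (intro tendsto_intros)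
  then have "((\<lambda>\<delta>. K * \<delta>) \<longlongrightarrow> 0) (at_right 0)" by simp
  moreover have "\<forall>\<^sub>F \<delta> in at_right 0. norm (res \<delta> - xs) \<le> K * \<delta>"
    using bound by (simp add: eventually_at_filter)
  ultimately have "((\<lambda>\<delta>. res \<delta> - xs) \<longlongrightarrow> 0) (at_right 0)" by (rule Lim_null_comparison[rotated])
  then show ?thesis unfolding res_def[symmetric] by (rule LIM_zero_cancel)
qed

end
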